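(* Let $P$ be a finite poset with at least two elements and let $L(P)$ be the distributive lattice of poset ideals of $P$. Then the following conditions are equivalent: (2) $P$ is a $\{(2+2),(1+1+1)\}$-free poset that is irreducible with respect to ordinal sum; (3) $L(P)$ is (isomorphic to) a generalized snake poset.
   Context: For a finite poset $P$, a poset ideal is a subset $\alpha\subseteq P$ such that $a\in\alpha$, $b\in P$, $b\le_P a$ imply $b\in\alpha$. $L(P)$ is the set of all poset ideals of $P$ (including $\emptyset$ and $P$), ordered by inclusion; it is a finite distributive lattice with meet $\cap$ and join $\cup$. The ordinal sum $P\oplus Q$ of posets $P,Q$ is the poset on the disjoint union $P\cup Q$ with $a\le b$ iff (i) $a,b\in P$ and $a\le_P b$, (ii) $a,b\in Q$ and $a\le_Q b$, or (iii) $a\in P$ and $b\in Q$. $P$ is irreducible with respect to ordinal sum if it cannot be written as the ordinal sum of two proper (nonempty) subposets of $P$. Subposets carry the induced order. The poset $(2+2)$ is the disjoint union of two $2$-element chains (elements of different chains being incomparable); $(1+1+1)$ is the $3$-element antichain. $P$ is $\{(2+2),(1+1+1)\}$-free if it contains no subposet isomorphic to $(2+2)$ and none isomorphic to $(1+1+1)$. A generalized snake word is a word $\mathbf{w}=w_0w_1\cdots w_l$ with $l\ge 0$, $w_0=\epsilon$ the empty letter, and $w_i\in\{L,R\}$ for $1\le i\le l$. The generalized snake poset $P(\mathbf{w})$ is defined recursively ($\lessdot$ denotes the cover relation): - $P(\epsilon)$ is the poset on $\{\alpha_0,\alpha_1,\alpha_2,\alpha_3\}$ with cover relations $\alpha_0\lessdot\alpha_1$,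 $\alpha_0\lessdot\alpha_2$, $\alpha_1\lessdot\alpha_3$, $\alpha_2\lessdot\alpha_3$. - $P(w_0\cdots w_l)$ is $P(w_0\cdots w_{l-1})\cup\{\alpha_{2l+2},\alpha_{2l+3}\}$ with the added cover relations $\alpha_{2l+1}\lessdot\alpha_{2l+3}$, $\alpha_{2l+2}\lessdot\alpha_{2l+3}$, and: $\alpha_{2l-1}\lessdot\alpha_{2l+2}$ if ($l=1$ and $w_l=L$) or ($l\ge2$ and $w_{l-1}w_l\in\{RL,LR\}$); $\alpha_{2l}\lessdot\alpha_{2l+2}$ if ($l=1$ and $w_l=R$) or ($l\ge 2$ and $w_{l-1}w_l\in\{LL,RR\}$). A generalized snake poset is a poset of the form $P(\mathbf{w})$ for some generalized snake word $\mathbf{w}$. *)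

theory Defs
  imports Main
begin

text \<open>
  A poset is given by a carrier set \<open>P\<close> and its (reflexive) order relation \<open>r\<close> with
  \<open>partial_order_on P r\<close>; a pair \<open>(a, b) \<in> r\<close> means \<open>a \<le> b\<close>.  The subposet on \<open>S \<subseteq> P\<close> is \<open>S\<close>
  with \<open>Restr r S\<close>.
\<close>

definition poset_isomorphic :: "'a set \<Rightarrow> 'a rel \<Rightarrow> 'b set \<Rightarrow> 'b rel \<Rightarrow> bool" where
  "poset_isomorphic P r Q s \<longleftrightarrow>
     (\<exists>f. bij_betw f P Q \<and> (\<forall>a\<in>P. \<forall>b\<in>P. (a, b) \<in> r \<longleftrightarrow> (f a, f b) \<in> s))"

definition contains_subposet :: "'a set \<Rightarrow> 'a rel \<Rightarrow> 'b set \<Rightarrow> 'b rel \<Rightarrow> bool" where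
  "contains_subposet P r Q s \<longleftrightarrow> (\<exists>S\<subseteq>P. poset_isomorphic S (Restr r S) Q s)"

definition poset_ideals :: "'a set \<Rightarrow> 'a rel \<Rightarrow> 'a set set" where
  "poset_ideals P r = {\<alpha>. \<alpha> \<subseteq> P \<and> (\<forall>a\<in>\<alpha>. \<forall>b\<in>P. (b, a) \<in> r \<longrightarrow> b \<in> \<alpha>)}"

definition ideal_order :: "'a set \<Rightarrow> 'a rel \<Rightarrow> 'a set rel" where
  "ideal_order P r = {(\<alpha>, \<beta>). \<alpha> \<in> poset_ideals P r \<and> \<beta> \<in> poset_ideals P r \<and> \<alpha> \<subseteq> \<beta>}"

text \<open>The order of the ordinal sum on \<open>A \<union> B\<close>; only meaningful when \<open>A\<close> and \<open>B\<close> are disjoint.\<close>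

definition ordinal_sum_order :: "'a set \<Rightarrow> 'a rel \<Rightarrow> 'a set \<Rightarrow> 'a rel \<Rightarrow> 'a rel" where
  "ordinal_sum_order A r B s = r \<union> s \<union> A \<times> B"

definition ordinal_sum_irreducible :: "'a set \<Rightarrow> 'a rel \<Rightarrow> bool" where
  "ordinal_sum_irreducible P r \<longleftrightarrow>
     \<not> (\<exists>A B. A \<noteq> {} \<and> B \<noteq> {} \<and> A \<inter> B = {} \<and> A \<union> B = P \<and>
            r = ordinal_sum_order A (Restr r A) B (Restr r B))"

text \<open>The poset (2+2): the chains \<open>0 < 1\<close> and \<open>2 < 3\<close>, mutually incomparable.\<close>

definition two_plus_two_carrier :: "nat set" where
  "two_plus_two_carrier = {0, 1, 2, 3}"

definition two_plus_two_order :: "nat rel" where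
  "two_plus_two_order = Id_on two_plus_two_carrier \<union> {(0, 1), (2, 3)}"

definition antichain3_carrier :: "nat set" where
  "antichain3_carrier = {0, 1, 2}"

definition antichain3_order :: "nat rel" where
  "antichain3_order = Id_on antichain3_carrier"

definition two_two_one_one_one_free :: "'a set \<Rightarrow> 'a rel \<Rightarrow> bool" where
  "two_two_one_one_one_free P r \<longleftrightarrow>
     \<not> contains_subposet P r two_plus_two_carrier two_plus_two_order \<and>
     \<not> contains_subposet P r antichain3_carrier antichain3_order"

text \<open>
  A word \<open>w\<^sub>0 w\<^sub>1 \<dots> w\<^sub>l\<close> with \<open>w\<^sub>0\<close> the empty letter is represented by the list
  \<open>[w\<^sub>1, \<dots>, w\<^sub>l]\<close>, so that \<open>w\<^sub>i\<close> is \<open>w ! (i - 1)\<close>.  The vertex \<open>\<alpha>\<^sub>i\<close> is the number \<open>i\<close>.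
\<close>

datatype letter = L | R

text \<open>
  \<open>snake_covers w l\<close> are the cover relations of the snake poset of the prefix \<open>w\<^sub>0 \<dots> w\<^sub>l\<close>
  (for \<open>l \<le> length w\<close>).
\<close>

fun snake_covers :: "letter list \<Rightarrow> nat \<Rightarrow> nat rel" where
  "snake_covers w 0 = {(0, 1), (0, 2), (1, 3), (2, 3)}"
| "snake_covers w (Suc k) =
    (let l = Suc k; letter = (\<lambda>i. w ! (i - 1)) in
      snake_covers w k \<union> {(2*l + 1, 2*l + 3), (2*l + 2, 2*l + 3)} \<union>
      (if (l = 1 \<and> letter l = L) \<or>
          (l \<ge> 2 \<and> (letter (l - 1), letter l) \<in> {(R, L), (L, R)})
       then {(2*l - 1, 2*l + 2)} else {}) \<union>
      (if (l = 1 \<and> letter l = R) \<or>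
          (l \<ge> 2 \<and> (letter (l - 1), letter l) \<in> {(L, L), (R, R)})
       then {(2*l, 2*l + 2)} else {}))"

definition snake_carrier :: "letter list \<Rightarrow> nat set" where
  "snake_carrier w = {0..2 * length w + 3}"

definition snake_order :: "letter list \<Rightarrow> nat rel" where
  "snake_order w = Restr ((snake_covers w (length w))\<^sup>*) (snake_carrier w)"

definition isomorphic_to_generalized_snake_poset :: "'a set \<Rightarrow> 'a rel \<Rightarrow> bool" where
  "isomorphic_to_generalized_snake_poset P r \<longleftrightarrow>
     (\<exists>w. poset_isomorphic P r (snake_carrier w) (snake_order w))"

end

theory Submission
  imports Defs
begin

text \<open>
  Both conditions on \<open>P\<close> are properties of the order of \<open>L(P)\<close> alone.  The poset \<open>P\<close> avoids
  \<open>(2+2)\<close> and \<open>(1+1+1)\<close> exactly when no three ideals are pairwise incomparable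
  (\<open>free_iff_no_ideal_antichain\<close>), and a decomposition \<open>P = C \<oplus> (P - C)\<close> is the same thing as an
  ideal \<open>C\<close> other than \<open>{}\<close> and \<open>P\<close> that is comparable with every ideal
  (\<open>irreducible_iff_no_cut_ideal\<close>).  A poset with neither an antichain of three elements nor
  such a cut element is called slim here.  Slimness is invariant under isomorphism, so it remains
  to see that \<open>L(P)\<close> is slim iff it is a generalized snake poset.

  A generalized snake poset is a ladder: between a bottom and a top vertex every rank holds two
  vertices; from the second of these ranks on, one of them covers both vertices of the rank below
  and the other covers one of the two.  The word only says which one, and every sequence of
  choices comes from a word
  (\<open>generalized_snake_iff_ladder\<close>).  A ladder is slim because the vertex that covers both lies
  above everything of smaller rank (\<open>ladder_slim\<close>).

  Conversely, \<open>L(P)\<close> is graded by cardinality.  If it is slim, there are at most two ideals of each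
  size, as ideals of equal size are incomparable, and at least two of each size \<open>0 < m < card P\<close>,
  as a single one would be comparable with every ideal.  The union of the two ideals of size \<open>m\<close>
  has only one element more, since otherwise the grid between their intersection and their union
  would contain a third ideal of size \<open>m\<close> (\<open>level_pair\<close>).  This union is the vertex that covers
  both, and the other ideal of size \<open>m + 1\<close> contains exactly one of the two
  (\<open>one_lower_neighbour\<close>).  Hence \<open>L(P)\<close> is a ladder (\<open>slim_ideals_ladder\<close>).
\<close>

section \<open>Slim posets\<close>

definition incomparable :: "'a rel \<Rightarrow> 'a \<Rightarrow> 'a \<Rightarrow> bool" where
  "incomparable s x y \<longleftrightarrow> (x, y) \<notin> s \<and> (y, x) \<notin> s"

definition antichain_of_three :: "'a set \<Rightarrow> 'a rel \<Rightarrow> bool" where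
  "antichain_of_three S s \<longleftrightarrow>
     (\<exists>x\<in>S. \<exists>y\<in>S. \<exists>z\<in>S. incomparable s x y \<and> incomparable s x z \<and> incomparable s y z)"

text \<open>
  In a poset with least and greatest element, a cut element is any other element that is
  comparable with everything.
\<close>

definition cut_element :: "'a set \<Rightarrow> 'a rel \<Rightarrow> 'a \<Rightarrow> bool" where
  "cut_element S s c \<longleftrightarrow> c \<in> S \<and> (\<forall>x\<in>S. (c, x) \<in> s \<or> (x, c) \<in> s) \<and>
     (\<exists>x\<in>S. (c, x) \<notin> s) \<and> (\<exists>x\<in>S. (x, c) \<notin> s)"

definition slim :: "'a set \<Rightarrow> 'a rel \<Rightarrow> bool" where
  "slim S s \<longleftrightarrow> \<not> antichain_of_three S s \<and> (\<nexists>c. cut_element S s c)"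

lemma antichain_of_threeI:
  "x \<in> S \<Longrightarrow> y \<in> S \<Longrightarrow> z \<in> S \<Longrightarrow> incomparable s x y \<Longrightarrow> incomparable s x z \<Longrightarrow>
     incomparable s y z \<Longrightarrow> antichain_of_three S s"
  by (auto simp: antichain_of_three_def)

lemma slim_if_isomorphic:
  assumes "poset_isomorphic S s T t" and "slim T t"
  shows "slim S s"
proof -
  obtain f where f: "bij_betw f S T" and ord: "\<And>a b. a \<in> S \<Longrightarrow> b \<in> S \<Longrightarrow> (a, b) \<in> s \<longleftrightarrow> (f a, f b) \<in> t"
    using assms(1) unfolding poset_isomorphic_def by blast
  have im: "T = f ` S" using f by (simp add: bij_betw_def)
  have "antichain_of_three T t" if three: "antichain_of_three S s"
  proof -
    obtain x y z where "x \<in> S" "y \<in> S" "z \<in> S"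
      "incomparable s x y" "incomparable s x z" "incomparable s y z"
      using three unfolding antichain_of_three_def by blast
    then show ?thesis
      by (intro antichain_of_threeI[of "f x" _ "f y" "f z"]) (auto simp: incomparable_def ord im)
  qed
  moreover have "cut_element T t (f c)" if "cut_element S s c" for c
    using that ord unfolding cut_element_def im by auto
  ultimately show ?thesis using assms(2) unfolding slim_def by blast
qed

lemma poset_isomorphic_sym:
  assumes "poset_isomorphic S s T t"
  shows "poset_isomorphic T t S s"
proof -
  obtain f where f: "bij_betw f S T" and ord: "\<forall>a\<in>S. \<forall>b\<in>S. (a, b) \<in> s \<longleftrightarrow> (f a, f b) \<in> t"
    using assms unfolding poset_isomorphic_def by blast
  let ?g = "inv_into S f"
  have g: "bij_betw ?g T S" using f by (rule bij_betw_inv_into)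
  have "\<forall>a\<in>T. \<forall>b\<in>T. (a, b) \<in> t \<longleftrightarrow> (?g a, ?g b) \<in> s"
    using ord bij_betwE[OF g] bij_betw_inv_into_right[OF f] by simp
  with g show ?thesis unfolding poset_isomorphic_def by blast
qed

section \<open>Forbidden subposets by their elements\<close>

text \<open>
  Naming the elements of a copy of a small poset by an embedding is easier than by the
  isomorphism from an unnamed subset of \<open>P\<close>.
\<close>

lemma contains_subposet_iff_embedding:
  "contains_subposet P r Q s \<longleftrightarrow>
     (\<exists>g. inj_on g Q \<and> g ` Q \<subseteq> P \<and> (\<forall>a\<in>Q. \<forall>b\<in>Q. (a, b) \<in> s \<longleftrightarrow> (g a, g b) \<in> r))"
proof
  assume "contains_subposet P r Q s"
  then obtain S where S: "S \<subseteq> P" and iso: "poset_isomorphic S (Restr r S) Q s"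
    unfolding contains_subposet_def by blast
  obtain g where g: "bij_betw g Q S" and ord: "\<forall>a\<in>Q. \<forall>b\<in>Q. (a, b) \<in> s \<longleftrightarrow> (g a, g b) \<in> Restr r S"
    using poset_isomorphic_sym[OF iso] unfolding poset_isomorphic_def by blast
  then have "\<forall>a\<in>Q. \<forall>b\<in>Q. (a, b) \<in> s \<longleftrightarrow> (g a, g b) \<in> r"
    by (auto dest: bij_betwE)
  then show "\<exists>g. inj_on g Q \<and> g ` Q \<subseteq> P \<and> (\<forall>a\<in>Q. \<forall>b\<in>Q. (a, b) \<in> s \<longleftrightarrow> (g a, g b) \<in> r)"
    using g S unfolding bij_betw_def by blast
next
  assume "\<exists>g. inj_on g Q \<and> g ` Q \<subseteq> P \<and> (\<forall>a\<in>Q. \<forall>b\<in>Q. (a, b) \<in> s \<longleftrightarrow> (g a, g b) \<in> r)"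
  then obtain g where g: "inj_on g Q" "g ` Q \<subseteq> P"
    and ord: "\<forall>a\<in>Q. \<forall>b\<in>Q. (a, b) \<in> s \<longleftrightarrow> (g a, g b) \<in> r"
    by blast
  have "poset_isomorphic Q s (g ` Q) (Restr r (g ` Q))"
    unfolding poset_isomorphic_def
    by (rule exI[of _ g]) (use g(1) ord in \<open>auto simp: bij_betw_def\<close>)
  then show "contains_subposet P r Q s"
    using g(2) unfolding contains_subposet_def by (blast dest: poset_isomorphic_sym)
qed

lemma contains_subposetE:
  assumes "contains_subposet P r Q s"
  obtains g where "inj_on g Q" "g ` Q \<subseteq> P"
    "\<And>a b. a \<in> Q \<Longrightarrow> b \<in> Q \<Longrightarrow> (g a, g b) \<in> r \<longleftrightarrow> (a, b) \<in> s"
proof -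
  obtain g where "inj_on g Q \<and> g ` Q \<subseteq> P \<and> (\<forall>a\<in>Q. \<forall>b\<in>Q. (a, b) \<in> s \<longleftrightarrow> (g a, g b) \<in> r)"
    using assms unfolding contains_subposet_iff_embedding by (rule exE)
  then show thesis by (intro that[of g]) simp_all
qed

lemma contains_antichain3_iff:
  assumes "partial_order_on P r"
  shows "contains_subposet P r antichain3_carrier antichain3_order \<longleftrightarrow> antichain_of_three P r"
proof
  assume "contains_subposet P r antichain3_carrier antichain3_order"
  then obtain g where "inj_on g antichain3_carrier" and P: "g ` antichain3_carrier \<subseteq> P"
    and ord: "\<And>a b. a \<in> antichain3_carrier \<Longrightarrow> b \<in> antichain3_carrier \<Longrightarrow>
                (g a, g b) \<in> r \<longleftrightarrow> (a, b) \<in> antichain3_order"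
    by (rule contains_subposetE) blast
  have "incomparable r (g a) (g b)"
    if "a \<in> antichain3_carrier" "b \<in> antichain3_carrier" "a \<noteq> b" for a b
    using that by (simp add: incomparable_def ord antichain3_order_def Id_on_iff)
  then show "antichain_of_three P r"
    using P by (intro antichain_of_threeI[of "g 0" _ "g 1" "g 2"]) (auto simp: antichain3_carrier_def)
next
  assume "antichain_of_three P r"
  then obtain x y z where P: "x \<in> P" "y \<in> P" "z \<in> P"
    and inc: "incomparable r x y" "incomparable r x z" "incomparable r y z"
    unfolding antichain_of_three_def by blast
  have refl: "(x, x) \<in> r" "(y, y) \<in> r" "(z, z) \<in> r"
    using assms P by (auto simp: partial_order_on_def preorder_on_def refl_on_def)
  have ne: "x \<noteq> y" "x \<noteq> z" "y \<noteq> z" using inc refl by (auto simp: incomparable_def)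
  define g :: "nat \<Rightarrow> _" where "g = (\<lambda>n. if n = 0 then x else if n = 1 then y else z)"
  have val: "g 0 = x" "g 1 = y" "g 2 = z" by (simp_all add: g_def)
  show "contains_subposet P r antichain3_carrier antichain3_order"
    unfolding contains_subposet_iff_embedding antichain3_order_def antichain3_carrier_def Id_on_iff
    by (rule exI[of _ g])
       (use P ne refl inc in \<open>simp add: val[unfolded One_nat_def] val incomparable_def\<close>)
qed

lemma contains_two_plus_two_iff:
  assumes "partial_order_on P r"
  shows "contains_subposet P r two_plus_two_carrier two_plus_two_order \<longleftrightarrow>
    (\<exists>a\<in>P. \<exists>b\<in>P. \<exists>c\<in>P. \<exists>d\<in>P. (a, b) \<in> r \<and> (c, d) \<in> r \<and> a \<noteq> b \<and> c \<noteq> d \<and>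
       incomparable r a c \<and> incomparable r a d \<and> incomparable r b c \<and> incomparable r b d)"
    (is "?lhs \<longleftrightarrow> ?rhs")
proof
  assume ?lhs
  then obtain g where inj: "inj_on g two_plus_two_carrier" and P: "g ` two_plus_two_carrier \<subseteq> P"
    and ord: "\<And>a b. a \<in> two_plus_two_carrier \<Longrightarrow> b \<in> two_plus_two_carrier \<Longrightarrow>
                (g a, g b) \<in> r \<longleftrightarrow> (a, b) \<in> two_plus_two_order"
    by (rule contains_subposetE) blast
  have le: "(g a, g b) \<in> r \<longleftrightarrow> a = b \<or> (a, b) = (0, 1) \<or> (a, b) = (2, 3)"
    if "a \<in> two_plus_two_carrier" "b \<in> two_plus_two_carrier" for a b
    unfolding ord[OF that] two_plus_two_order_def using that by auto
  have mem: "0 \<in> two_plus_two_carrier" "1 \<in> two_plus_two_carrier" "2 \<in> two_plus_two_carrier"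
    "3 \<in> two_plus_two_carrier"
    by (simp_all add: two_plus_two_carrier_def)
  have "g 0 \<noteq> g 1" "g 2 \<noteq> g 3"
    using inj_onD[OF inj _ mem(1,2)] inj_onD[OF inj _ mem(3,4)] by auto
  moreover have "incomparable r (g 0) (g 2)" "incomparable r (g 0) (g 3)"
    "incomparable r (g 1) (g 2)" "incomparable r (g 1) (g 3)" "(g 0, g 1) \<in> r" "(g 2, g 3) \<in> r"
    unfolding incomparable_def by (simp_all only: le mem) simp_all
  moreover have "g 0 \<in> P" "g 1 \<in> P" "g 2 \<in> P" "g 3 \<in> P" using P mem by blast+
  ultimately show ?rhs by blast
next
  assume ?rhs
  then obtain a b c d where P: "a \<in> P" "b \<in> P" "c \<in> P" "d \<in> P"
    and le: "(a, b) \<in> r" "(c, d) \<in> r" "a \<noteq> b" "c \<noteq> d"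
    and inc: "incomparable r a c" "incomparable r a d" "incomparable r b c" "incomparable r b d"
    by blast
  have refl: "(a, a) \<in> r" "(b, b) \<in> r" "(c, c) \<in> r" "(d, d) \<in> r"
    using assms P by (auto simp: partial_order_on_def preorder_on_def refl_on_def)
  have nle: "(b, a) \<notin> r" "(d, c) \<notin> r"
    using assms le by (auto simp: partial_order_on_def antisym_def)
  have ne: "a \<noteq> c" "a \<noteq> d" "b \<noteq> c" "b \<noteq> d" using inc refl by (auto simp: incomparable_def)
  define g :: "nat \<Rightarrow> _" where
    "g = (\<lambda>n. if n = 0 then a else if n = 1 then b else if n = 2 then c else d)"
  have val: "g 0 = a" "g 1 = b" "g 2 = c" "g 3 = d" by (simp_all add: g_def)
  show ?lhs
    unfolding contains_subposet_iff_embedding two_plus_two_order_def two_plus_two_carrier_def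
      Un_iff Id_on_iff
    by (rule exI[of _ g])
       (use P ne le nle refl inc in \<open>simp add: val[unfolded One_nat_def] val incomparable_def\<close>)
qed

section \<open>The lattice of ideals\<close>

locale finite_poset =
  fixes P :: "'a set" and r :: "'a rel"
  assumes partial_order: "partial_order_on P r"
    and finite_carrier: "finite P"
begin

abbreviation ideals :: "'a set set" where
  "ideals \<equiv> poset_ideals P r"

definition level :: "nat \<Rightarrow> 'a set set" where
  "level m = {A \<in> ideals. card A = m}"

definition down :: "'a \<Rightarrow> 'a set" where
  "down x = {y. (y, x) \<in> r}"

lemma
  shows r_subset: "r \<subseteq> P \<times> P"
    and r_refl: "x \<in> P \<Longrightarrow> (x, x) \<in> r"
    and r_trans: "(x, y) \<in> r \<Longrightarrow> (y, z) \<in> r \<Longrightarrow> (x, z) \<in> r"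
    and r_antisym: "(x, y) \<in> r \<Longrightarrow> (y, x) \<in> r \<Longrightarrow> x = y"
  using partial_order
  by (auto simp: partial_order_on_def preorder_on_def refl_on_def antisym_def dest: transD)

lemma ideal_subset: "A \<in> ideals \<Longrightarrow> A \<subseteq> P"
  by (simp add: poset_ideals_def)

lemma ideal_down_closed: "A \<in> ideals \<Longrightarrow> y \<in> A \<Longrightarrow> (x, y) \<in> r \<Longrightarrow> x \<in> A"
  using r_subset by (auto simp: poset_ideals_def)

lemma finite_ideal: "A \<in> ideals \<Longrightarrow> finite A"
  using ideal_subset finite_carrier finite_subset by blast

lemma down_ideal: "down x \<in> ideals"
  using r_subset r_trans by (auto simp: down_def poset_ideals_def)

lemma empty_ideal: "{} \<in> ideals" and carrier_ideal: "P \<in> ideals"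
  by (auto simp: poset_ideals_def)

lemma Un_ideal: "A \<in> ideals \<Longrightarrow> B \<in> ideals \<Longrightarrow> A \<union> B \<in> ideals"
  and Int_ideal: "A \<in> ideals \<Longrightarrow> B \<in> ideals \<Longrightarrow> A \<inter> B \<in> ideals"
  by (auto simp: poset_ideals_def)

lemma ideal_order_iff:
  "A \<in> ideals \<Longrightarrow> B \<in> ideals \<Longrightarrow> (A, B) \<in> ideal_order P r \<longleftrightarrow> A \<subseteq> B"
  by (simp add: ideal_order_def)

lemma incomparable_ideals_iff:
  "A \<in> ideals \<Longrightarrow> B \<in> ideals \<Longrightarrow>
     incomparable (ideal_order P r) A B \<longleftrightarrow> \<not> A \<subseteq> B \<and> \<not> B \<subseteq> A"
  by (simp add: incomparable_def ideal_order_iff)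

lemma cut_ideal_iff:
  "cut_element ideals (ideal_order P r) C \<longleftrightarrow>
     C \<in> ideals \<and> (\<forall>X\<in>ideals. C \<subseteq> X \<or> X \<subseteq> C) \<and> C \<noteq> {} \<and> C \<noteq> P"
proof (cases "C \<in> ideals")
  case True
  have "(\<exists>X\<in>ideals. \<not> C \<subseteq> X) \<longleftrightarrow> C \<noteq> {}" using empty_ideal by blast
  moreover have "(\<exists>X\<in>ideals. \<not> X \<subseteq> C) \<longleftrightarrow> C \<noteq> P"
    using carrier_ideal ideal_subset True by blast
  ultimately show ?thesis using True by (simp add: cut_element_def ideal_order_iff)
qed (simp add: cut_element_def)

text \<open>
  The lattice of ideals is graded by cardinality: a maximal element of \<open>C - A\<close> is also maximal in
  \<open>C\<close>, because an element of \<open>A\<close> has nothing outside \<open>A\<close> below it, so it can be removed from \<open>C\<close>.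
\<close>

lemma ideal_between:
  assumes "A \<in> ideals" "C \<in> ideals" "A \<subseteq> C" "card A \<le> m" "m \<le> card C"
  obtains B where "B \<in> level m" "A \<subseteq> B" "B \<subseteq> C"
proof -
  have "\<exists>B\<in>level m. A \<subseteq> B \<and> B \<subseteq> C"
    using assms
  proof (induction "card C - m" arbitrary: C)
    case 0
    then show ?case by (auto simp: level_def)
  next
    case (Suc n)
    have "C - A \<noteq> {}" using Suc.hyps Suc.prems by auto
    moreover have "finite (C - A)" using Suc.prems finite_ideal by blast
    ultimately obtain x where x: "x \<in> C - A" and max: "\<forall>y\<in>C - A. y \<noteq> x \<longrightarrow> (x, y) \<notin> r"
      using Finite_Set.bex_max_element[of "C - A" "\<lambda>x y. (x, y) \<in> r \<and> x \<noteq> y"]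
        r_trans r_antisym
      by (smt (verit) asymp_onI transp_onI)
    have "x \<noteq> b" if "a \<in> C - {x}" "(b, a) \<in> r" for a b
      using that x max ideal_down_closed[OF \<open>A \<in> ideals\<close>, of a x] by blast
    then have "C - {x} \<in> ideals"
      using ideal_down_closed[OF \<open>C \<in> ideals\<close>] ideal_subset[OF \<open>C \<in> ideals\<close>]
      by (auto simp: poset_ideals_def)
    moreover have "card (C - {x}) = card C - 1"
      using x by (simp add: card_Diff_singleton)
    moreover have "n = card (C - {x}) - m" "A \<subseteq> C - {x}" "m \<le> card (C - {x})"
      using \<open>card (C - {x}) = card C - 1\<close> Suc.hyps(2) Suc.prems x by auto
    ultimately have "\<exists>B\<in>level m. A \<subseteq> B \<and> B \<subseteq> C - {x}"
      using Suc.hyps(1) Suc.prems by blast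
    then show ?case by blast
  qed
  then show thesis using that by blast
qed

text \<open>
  Here \<open>A\<close> has no element of its own.  Witnesses \<open>x\<close> of \<open>\<not> A \<subseteq> C\<close> and \<open>y\<close> of \<open>\<not> A \<subseteq> B\<close> then lie in
  \<open>A \<inter> B\<close> and \<open>A \<inter> C\<close>.  An element of \<open>B \<inter> C - A\<close> would form a three-element antichain with them.
  Without one, witnesses \<open>z\<close> of \<open>\<not> B \<subseteq> A\<close> and \<open>u\<close> of \<open>\<not> C \<subseteq> A\<close> lie in only one of the three ideals,
  and the only comparabilities left are \<open>x < z\<close> and \<open>y < u\<close>.  If both hold they form a \<open>(2+2)\<close>, and
  if one fails there is again an antichain.
\<close>

lemma not_free_if_covered:
  assumes I: "A \<in> ideals" "B \<in> ideals" "C \<in> ideals" and cover: "A \<subseteq> B \<union> C"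
    and inc: "\<not> A \<subseteq> B" "\<not> B \<subseteq> A" "\<not> A \<subseteq> C" "\<not> C \<subseteq> A" "\<not> B \<subseteq> C" "\<not> C \<subseteq> B"
  shows "\<not> two_two_one_one_one_free P r"
proof
  assume free: "two_two_one_one_one_free P r"
  have no3: False
    if "incomparable r x y" "incomparable r x z" "incomparable r y z" "x \<in> P" "y \<in> P" "z \<in> P" for x y z
    using free that unfolding two_two_one_one_one_free_def contains_antichain3_iff[OF partial_order]
      antichain_of_three_def by blast
  have incI: "incomparable r u v" if "X \<in> ideals" "Y \<in> ideals" "u \<in> X - Y" "v \<in> Y - X" for u v X Y
    using that ideal_down_closed unfolding incomparable_def by blast
  obtain x y where x: "x \<in> A" "x \<in> B" "x \<notin> C" and y: "y \<in> A" "y \<in> C" "y \<notin> B"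
    using inc cover by blast
  have P: "p \<in> P" if "p \<in> A \<union> B \<union> C" for p using that I ideal_subset by blast
  have xy: "incomparable r x y" using incI[OF I(2,3)] x y by blast
  have "B \<inter> C \<subseteq> A"
  proof
    fix v assume v: "v \<in> B \<inter> C"
    show "v \<in> A"
    proof (rule ccontr)
      assume "v \<notin> A"
      then have "incomparable r x v" "incomparable r y v"
        using incI[OF I(1,3)] incI[OF I(1,2)] v x y by blast+
      then show False using no3[of x y v] xy P x y v by blast
    qed
  qed
  then obtain z u where z: "z \<in> B" "z \<notin> A" "z \<notin> C" and u: "u \<in> C" "u \<notin> A" "u \<notin> B"
    using inc by blast
  have yz: "incomparable r y z" and xu: "incomparable r x u" and zu: "incomparable r z u"
    using incI[OF I(3,2)] incI[OF I(2,3)] x y z u by blast+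
  have "(z, x) \<notin> r" "(u, y) \<notin> r" using ideal_down_closed[OF I(1)] x y z u by blast+
  moreover have "\<not> incomparable r x z" "\<not> incomparable r y u"
    using no3[of x y z] no3[of x y u] xy yz xu P x y z u by blast+
  ultimately have le: "(x, z) \<in> r" "(y, u) \<in> r" by (auto simp: incomparable_def)
  have zy: "incomparable r z y" using yz by (auto simp: incomparable_def)
  have "x \<noteq> z" "y \<noteq> u" using x y z u by auto
  then show False
    using free le xy xu zy zu P x y z u
    unfolding two_two_one_one_one_free_def contains_two_plus_two_iff[OF partial_order] by blast
qed

text \<open>
  An antichain \<open>x, y, z\<close> of \<open>P\<close> yields the antichain of its principal ideals, and a copy
  \<open>a < b, c < d\<close> of \<open>(2+2)\<close> yields the three ideals \<open>down b\<close>, \<open>down a \<union> down c\<close> and \<open>down d\<close>.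
  Conversely, if each of three ideals has an element that lies in neither of the others, these
  elements are pairwise incomparable; otherwise one of the ideals is covered by the other two.
\<close>

lemma free_iff_no_ideal_antichain:
  "two_two_one_one_one_free P r \<longleftrightarrow> \<not> antichain_of_three ideals (ideal_order P r)"
proof -
  have from_antichain: "antichain_of_three ideals (ideal_order P r)"
    if inc: "incomparable r x y" "incomparable r x z" "incomparable r y z"
      and P: "x \<in> P" "y \<in> P" "z \<in> P" for x y z
  proof -
    have mem: "x \<in> down x" "y \<in> down y" "z \<in> down z"
      using P r_refl by (auto simp: down_def)
    have nmem: "x \<notin> down y" "x \<notin> down z" "y \<notin> down x" "y \<notin> down z" "z \<notin> down x" "z \<notin> down y"
      using inc by (auto simp: down_def incomparable_def)
    show ?thesis
      by (rule antichain_of_threeI[of "down x" _ "down y" "down z"])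
         (use mem nmem in \<open>auto simp: incomparable_ideals_iff down_ideal\<close>)
  qed
  have from_two_plus_two: "antichain_of_three ideals (ideal_order P r)"
    if le: "(a, b) \<in> r" "(c, d) \<in> r" "a \<noteq> b" "c \<noteq> d"
      and inc: "incomparable r a c" "incomparable r a d" "incomparable r b c" "incomparable r b d"
      and P: "a \<in> P" "b \<in> P" "c \<in> P" "d \<in> P" for a b c d
  proof -
    have mem: "a \<in> down a" "b \<in> down b" "c \<in> down c" "d \<in> down d" "c \<in> down d" "a \<in> down b"
      using P r_refl le by (auto simp: down_def)
    have nmem: "b \<notin> down a" "d \<notin> down c" "c \<notin> down b" "a \<notin> down d" "b \<notin> down c" "d \<notin> down a"
      using le inc r_antisym by (auto simp: down_def incomparable_def)
    show ?thesis
      by (rule antichain_of_threeI[of "down b" _ "down a \<union> down c" "down d"])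
         (use mem nmem in \<open>auto simp: incomparable_ideals_iff down_ideal Un_ideal\<close>)
  qed
  have "\<not> antichain_of_three ideals (ideal_order P r)" if "two_two_one_one_one_free P r"
  proof
    assume "antichain_of_three ideals (ideal_order P r)"
    then obtain A B C where I: "A \<in> ideals" "B \<in> ideals" "C \<in> ideals"
      and inc: "\<not> A \<subseteq> B" "\<not> B \<subseteq> A" "\<not> A \<subseteq> C" "\<not> C \<subseteq> A" "\<not> B \<subseteq> C" "\<not> C \<subseteq> B"
      unfolding antichain_of_three_def by (auto simp: incomparable_ideals_iff)
    have "\<not> A \<subseteq> B \<union> C" "\<not> B \<subseteq> A \<union> C" "\<not> C \<subseteq> A \<union> B"
      using not_free_if_covered[of A B C] not_free_if_covered[of B A C]
        not_free_if_covered[of C A B] I inc that by auto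
    then obtain a b c where "a \<in> A - B - C" "b \<in> B - A - C" "c \<in> C - A - B" by blast
    then have "incomparable r a b" "incomparable r a c" "incomparable r b c" "a \<in> P" "b \<in> P" "c \<in> P"
      using I ideal_down_closed ideal_subset unfolding incomparable_def by blast+
    then show False
      using that unfolding two_two_one_one_one_free_def contains_antichain3_iff[OF partial_order]
        antichain_of_three_def by blast
  qed
  moreover have "two_two_one_one_one_free P r"
    if no3: "\<not> antichain_of_three ideals (ideal_order P r)"
    unfolding two_two_one_one_one_free_def
  proof
    show "\<not> contains_subposet P r two_plus_two_carrier two_plus_two_order"
      unfolding contains_two_plus_two_iff[OF partial_order]
      using from_two_plus_two no3 by blast
    show "\<not> contains_subposet P r antichain3_carrier antichain3_order"
      unfolding contains_antichain3_iff[OF partial_order] antichain_of_three_def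
      using from_antichain no3 by blast
  qed
  ultimately show ?thesis by blast
qed

text \<open>
  The lower summand of an ordinal sum is comparable with every ideal, because an ideal that
  reaches into the upper summand contains the whole lower one.  Conversely, if an ideal \<open>C\<close> is
  comparable with the principal ideal of some \<open>b \<notin> C\<close>, it is contained in it, so all of \<open>C\<close> lies
  below \<open>b\<close>.
\<close>

lemma irreducible_iff_no_cut_ideal:
  "ordinal_sum_irreducible P r \<longleftrightarrow> (\<nexists>C. cut_element ideals (ideal_order P r) C)"
proof -
  have cut: "cut_element ideals (ideal_order P r) A"
    if AB: "A \<noteq> {}" "B \<noteq> {}" "A \<inter> B = {}" "A \<union> B = P"
      and sum: "r = ordinal_sum_order A (Restr r A) B (Restr r B)" for A B
  proof -
    have below: "(a, b) \<in> r" if "a \<in> A" "b \<in> B" for a b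
      by (subst sum) (use that in \<open>simp add: ordinal_sum_order_def\<close>)
    have ideal: "A \<in> ideals"
      using AB below r_antisym unfolding poset_ideals_def by blast
    have "A \<subseteq> X \<or> X \<subseteq> A" if "X \<in> ideals" for X
      using that AB below ideal_down_closed[OF that] ideal_subset[OF that] by blast
    moreover have "A \<noteq> {}" "A \<noteq> P" using AB by auto
    ultimately show ?thesis using ideal by (simp add: cut_ideal_iff)
  qed
  have red: "\<not> ordinal_sum_irreducible P r" if "cut_element ideals (ideal_order P r) C" for C
  proof -
    have C: "C \<in> ideals" and cmp: "\<And>X. X \<in> ideals \<Longrightarrow> C \<subseteq> X \<or> X \<subseteq> C"
      and ne: "C \<noteq> {}" "C \<noteq> P"
      using that by (auto simp: cut_ideal_iff)
    have "(a, b) \<in> r" if "a \<in> C" "b \<in> P - C" for a b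
      using cmp[OF down_ideal, of b] that r_refl by (auto simp: down_def)
    then have "r = ordinal_sum_order C (Restr r C) (P - C) (Restr r (P - C))"
      using r_subset ideal_down_closed[OF C] unfolding ordinal_sum_order_def by blast
    moreover have "C \<inter> (P - C) = {}" "C \<union> (P - C) = P" "P - C \<noteq> {}"
      using ideal_subset[OF C] ne by auto
    ultimately show ?thesis
      unfolding ordinal_sum_irreducible_def not_not
      by - (rule exI[of _ C], rule exI[of _ "P - C"], intro conjI ne(1))
  qed
  show ?thesis
  proof
    assume "ordinal_sum_irreducible P r"
    then show "\<nexists>C. cut_element ideals (ideal_order P r) C" using red by blast
  next
    assume no_cut: "\<nexists>C. cut_element ideals (ideal_order P r) C"
    show "ordinal_sum_irreducible P r"
      unfolding ordinal_sum_irreducible_def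
    proof (intro notI, elim exE conjE)
      fix A B
      assume "A \<noteq> {}" "B \<noteq> {}" "A \<inter> B = {}" "A \<union> B = P"
        "r = ordinal_sum_order A (Restr r A) B (Restr r B)"
      then have "cut_element ideals (ideal_order P r) A" by (rule cut)
      with no_cut show False by blast
    qed
  qed
qed

text \<open>
  A third ideal of size \<open>m\<close> would complete an antichain, and a single one would be a cut element,
  since by gradedness every ideal lies above or below some ideal of size \<open>m\<close>.  If \<open>X\<close> and \<open>Y\<close>
  differed in more than one element each, exchanging only one element of \<open>X\<close> for one of \<open>Y\<close> would
  produce a third ideal.
\<close>

lemma level_pair:
  assumes slim: "slim ideals (ideal_order P r)" and m: "0 < m" "m < card P"
  obtains X Y where "X \<noteq> Y" "level m = {X, Y}" "X \<union> Y \<in> level (Suc m)"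
proof -
  obtain X where X: "X \<in> level m"
    using ideal_between[OF empty_ideal carrier_ideal, of m] m by auto
  have eqI: "A = B" if "A \<in> level m" "B \<in> level m" "A \<subseteq> B" for A B
    using that card_subset_eq[of B A] finite_ideal[of B] by (auto simp: level_def)
  have "level m \<noteq> {X}"
  proof
    assume single: "level m = {X}"
    have "X \<subseteq> Z \<or> Z \<subseteq> X" if Z: "Z \<in> ideals" for Z
    proof (cases "card Z \<le> m")
      case True
      then show ?thesis
        using ideal_between[OF Z carrier_ideal ideal_subset[OF Z], of m] m single by auto
    next
      case False
      then show ?thesis
        using ideal_between[OF empty_ideal Z, of m] single by auto
    qed
    moreover have "X \<in> ideals" "X \<noteq> {}" "X \<noteq> P" using X m by (auto simp: level_def)
    ultimately have "cut_element ideals (ideal_order P r) X" by (simp add: cut_ideal_iff)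
    with slim show False unfolding slim_def by blast
  qed
  with X obtain Y where Y: "Y \<in> level m" "Y \<noteq> X" by blast
  have pair: "Z = X \<or> Z = Y" if Z: "Z \<in> level m" for Z
  proof (rule ccontr)
    assume "\<not> (Z = X \<or> Z = Y)"
    then have "antichain_of_three ideals (ideal_order P r)"
      by (intro antichain_of_threeI[of X _ Y Z])
         (use X Y Z eqI in \<open>auto simp: level_def incomparable_ideals_iff\<close>)
    with slim show False unfolding slim_def by blast
  qed
  have I: "X \<in> ideals" "Y \<in> ideals" and card: "card X = m" "card Y = m"
    using X Y by (auto simp: level_def)
  have fin: "finite X" "finite Y" using I finite_ideal by auto
  have union: "card (X \<union> Y) = Suc m"
  proof (rule ccontr)
    assume ne: "card (X \<union> Y) \<noteq> Suc m"
    have "X \<subset> X \<union> Y" using eqI[of Y X] X Y by blast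
    then have gt: "Suc m < card (X \<union> Y)"
      using psubset_card_mono[of "X \<union> Y" X] fin card ne by auto
    have "card (X \<union> Y) + card (X \<inter> Y) = m + m"
      using card_Un_Int[OF fin] card by simp
    then have small: "card (X \<inter> Y) < m - 1" using gt by linarith
    \<comment> \<open>Step down from \<open>X\<close> once and up towards \<open>Y\<close> once.  Since \<open>V\<close> is still larger than \<open>X \<inter> Y\<close>,
      the result \<open>W\<close> differs from \<open>Y\<close>.\<close>
    obtain V where V: "V \<in> level (m - 1)" "X \<inter> Y \<subseteq> V" "V \<subseteq> X"
      using ideal_between[OF Int_ideal[OF I] I(1), of "m - 1"] small card by auto
    have VI: "V \<in> ideals" "card V = m - 1" using V by (auto simp: level_def)
    have "card Y \<le> card (V \<union> Y)" using VI fin finite_ideal by (intro card_mono) auto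
    then obtain W where W: "W \<in> level m" "V \<subseteq> W" "W \<subseteq> V \<union> Y"
      using ideal_between[OF VI(1) Un_ideal[OF VI(1) I(2)], of m] VI card by auto
    have "W \<noteq> Y"
    proof
      assume "W = Y"
      then have "V = X \<inter> Y" using V W by blast
      then show False using VI small by simp
    qed
    moreover have "W \<noteq> X"
    proof
      assume "W = X"
      then have "X = V" using V W by blast
      then show False using VI card m by simp
    qed
    ultimately show False using pair W by blast
  qed
  show thesis
    using that[of X Y] Y X pair union I Un_ideal by (auto simp: level_def)
qed

text \<open>
  Gradedness puts \<open>X\<close> or \<open>Y\<close> inside \<open>Z\<close>, and for reasons of size \<open>Z\<close> cannot contain both.
\<close>

lemma one_lower_neighbour:
  assumes "level m = {X, Y}" "level (Suc m) = {X \<union> Y, Z}" "Z \<noteq> X \<union> Y"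
  shows "Y \<subseteq> Z \<longleftrightarrow> \<not> X \<subseteq> Z"
proof -
  have Z: "Z \<in> ideals" "card Z = Suc m" and U: "card (X \<union> Y) = Suc m"
    using assms(2) by (auto simp: level_def)
  obtain V where "V \<in> level m" "V \<subseteq> Z"
    using ideal_between[OF empty_ideal Z(1), of m] Z(2) by auto
  then have "X \<subseteq> Z \<or> Y \<subseteq> Z" using assms(1) by auto
  moreover have "\<not> X \<union> Y \<subseteq> Z"
    using card_subset_eq[OF finite_ideal[OF Z(1)], of "X \<union> Y"] Z U assms(3) by auto
  ultimately show ?thesis by blast
qed

end

section \<open>Snakes as ladders\<close>

text \<open>
  The cover relations of a snake poset, with the word replaced by the choice \<open>t i\<close> whether the even
  vertex \<open>2*i + 4\<close> covers the odd or the even vertex of the rank below it.  The rank of a vertex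
  \<open>y\<close> is \<open>(y + 1) div 2\<close>.
\<close>

definition ladder :: "(nat \<Rightarrow> bool) \<Rightarrow> nat \<Rightarrow> nat rel" where
  "ladder t k = {(0, 1), (0, 2)} \<union>
     (\<Union>i\<le>k. {(2*i + 1, 2*i + 3), (2*i + 2, 2*i + 3)}) \<union>
     (\<Union>i<k. {(if t i then 2*i + 1 else 2*i + 2, 2*i + 4)})"

definition ladder_order :: "(nat \<Rightarrow> bool) \<Rightarrow> nat \<Rightarrow> nat rel" where
  "ladder_order t k = Restr ((ladder t k)\<^sup>*) {0..2*k + 3}"

text \<open>
  The choice made by the letter of index \<open>i\<close>: a change of letter selects the odd vertex.  The first
  letter has no predecessor and counts as a change iff it is \<open>L\<close>.
\<close>

definition turn :: "letter list \<Rightarrow> nat \<Rightarrow> bool" where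
  "turn w i \<longleftrightarrow> (if i = 0 then w ! 0 = L else w ! i \<noteq> w ! (i - 1))"

lemma snake_covers_eq_ladder: "snake_covers w k = ladder (turn w) k"
proof (induction k)
  case 0
  show ?case by (auto simp: ladder_def)
next
  case (Suc k)
  have top: "{(2 * Suc k + 1, 2 * Suc k + 3), (2 * Suc k + 2, 2 * Suc k + 3)} =
      {(2*k + 3, 2*k + 5), (2*k + 4, 2*k + 5)}" by (simp add: eval_nat_numeral)
  have step: "ladder t (Suc k) = ladder t k \<union> {(2*k + 3, 2*k + 5), (2*k + 4, 2*k + 5)} \<union>
      {(if t k then 2*k + 1 else 2*k + 2, 2*k + 4)}" for t
    unfolding ladder_def atMost_Suc lessThan_Suc UN_insert top by blast
  have odd: "(Suc k = 1 \<and> w ! (Suc k - 1) = L) \<or>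
      (Suc k \<ge> 2 \<and> (w ! (Suc k - 1 - 1), w ! (Suc k - 1)) \<in> {(R, L), (L, R)}) \<longleftrightarrow> turn w k"
    and even: "(Suc k = 1 \<and> w ! (Suc k - 1) = R) \<or>
      (Suc k \<ge> 2 \<and> (w ! (Suc k - 1 - 1), w ! (Suc k - 1)) \<in> {(L, L), (R, R)}) \<longleftrightarrow> \<not> turn w k"
    by (cases "w ! k"; cases "w ! (k - 1)"; auto simp: turn_def)+
  have covers: "snake_covers w (Suc k) =
      snake_covers w k \<union> {(2 * Suc k + 1, 2 * Suc k + 3), (2 * Suc k + 2, 2 * Suc k + 3)} \<union>
      (if turn w k then {(2 * Suc k - 1, 2 * Suc k + 2)} else {}) \<union>
      (if \<not> turn w k then {(2 * Suc k, 2 * Suc k + 2)} else {})"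
    unfolding snake_covers.simps(2) Let_def odd even by (rule refl)
  have rungs: "2 * Suc k - 1 = 2*k + 1" "2 * Suc k + 2 = 2*k + 4" "2 * Suc k = 2*k + 2" by simp_all
  show ?case
    unfolding covers step top Suc.IH rungs(1,2) unfolding rungs(3) by auto
qed

text \<open>
  Prescribed changes determine a word once its first letter is known.
\<close>

lemma word_with_turns:
  obtains w where "length w = k" "\<And>i. i < k \<Longrightarrow> turn w i = t i"
proof -
  define flip where "flip = (\<lambda>x. case x of L \<Rightarrow> R | R \<Rightarrow> L)"
  define g where "g = rec_nat (if t 0 then L else R) (\<lambda>i x. if t (Suc i) then flip x else x)"
  have "flip x \<noteq> x" for x by (cases x) (auto simp: flip_def)
  then have "turn (map g [0..<k]) i = t i" if "i < k" for i
    using that by (cases i) (auto simp: turn_def g_def)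
  then show thesis using that[of "map g [0..<k]"] by simp
qed

lemma ladder_cong:
  assumes "\<And>i. i < k \<Longrightarrow> t i = u i"
  shows "ladder t k = ladder u k"
  using assms by (simp add: ladder_def)

lemma generalized_snake_iff_ladder:
  "isomorphic_to_generalized_snake_poset S s \<longleftrightarrow>
     (\<exists>t k. poset_isomorphic S s {0..2*k + 3} (ladder_order t k))"
proof -
  have snake: "snake_order w = ladder_order (turn w) (length w)" for w
    by (simp add: snake_order_def ladder_order_def snake_carrier_def snake_covers_eq_ladder)
  have "\<exists>w. snake_carrier w = {0..2*k + 3} \<and> snake_order w = ladder_order t k" for t k
  proof -
    obtain w where "length w = k" "\<And>i. i < k \<Longrightarrow> turn w i = t i" using word_with_turns[of k t] by blast
    then show ?thesis
      using ladder_cong[of k "turn w" t]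
      by (intro exI[of _ w]) (simp add: snake ladder_order_def snake_carrier_def)
  qed
  then have "(\<exists>w. poset_isomorphic S s (snake_carrier w) (snake_order w))"
    if "poset_isomorphic S s {0..2*k + 3} (ladder_order t k)" for t k
    using that by metis
  moreover have "poset_isomorphic S s {0..2 * length w + 3} (ladder_order (turn w) (length w))"
    if "poset_isomorphic S s (snake_carrier w) (snake_order w)" for w
    using that by (simp add: snake snake_carrier_def)
  ultimately show ?thesis unfolding isomorphic_to_generalized_snake_poset_def by blast
qed

section \<open>Ladders are slim\<close>

lemma ladder_vertex_cases:
  fixes y :: nat
  obtains "y = 0" | i where "y = 2*i + 1" | i where "y = 2*i + 2"
proof (cases "y = 0")
  case False
  show thesis
  proof (cases "odd y")
    case True then show thesis using that(2) by (auto elim: oddE)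
  next
    case even: False
    then obtain j where "y = 2 * j" by auto
    with False show thesis using that(3)[of "j - 1"] by (cases j) auto
  qed
qed (use that in blast)

lemma ladder_rank:
  assumes "(x, y) \<in> (ladder t k)\<^sup>*"
  shows "x = y \<or> (x + 1) div 2 < (y + 1) div 2"
  using assms
proof (induction rule: rtrancl_induct)
  case base
  then show ?case by simp
next
  case (step y z)
  have "(z + 1) div 2 = Suc ((y + 1) div 2)"
    using step.hyps(2) by (auto simp: ladder_def)
  with step.IH show ?case by auto
qed

text \<open>
  An odd vertex covers both vertices of the preceding rank, one of which is again odd.
\<close>

lemma ladder_below_odd:
  assumes "odd y" "y \<le> 2*k + 3" "x \<le> y"
  shows "(x, y) \<in> (ladder t k)\<^sup>*"
proof -
  obtain i where "y = 2*i + 1" using \<open>odd y\<close> by (rule oddE)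
  then show ?thesis
    using assms(2,3)
  proof (induction i arbitrary: x y)
    case 0
    then have "x = 0 \<or> x = 1" "y = 1" by auto
    then show ?case by (auto simp: ladder_def)
  next
    case (Suc i)
    have y: "y = 2*i + 3" using Suc.prems(1) by simp
    then have "i \<le> k" using Suc.prems(2) by simp
    then have edge: "(2*i + 1, y) \<in> ladder t k" "(2*i + 2, y) \<in> ladder t k"
      unfolding y ladder_def by blast+
    consider "x \<le> 2*i + 1" | "x = 2*i + 2" | "x = y" using Suc.prems(3) y by linarith
    then show ?case
    proof cases
      case 1
      then have "(x, 2*i + 1) \<in> (ladder t k)\<^sup>*" using Suc.IH[of "2*i + 1" x] \<open>i \<le> k\<close> by simp
      then show ?thesis using edge(1) by (rule rtrancl_into_rtrancl)
    next
      case 2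
      then show ?thesis using edge(2) by blast
    next
      case 3
      then show ?thesis by simp
    qed
  qed
qed

lemma ladder_bottom:
  assumes "y \<le> 2*k + 3"
  shows "(0, y) \<in> (ladder t k)\<^sup>*"
  using assms
proof (induction y rule: less_induct)
  case (less y)
  show ?case
  proof (cases y rule: ladder_vertex_cases)
    case 1
    then show ?thesis by simp
  next
    case (2 i)
    then show ?thesis using less.prems ladder_below_odd[of y k 0 t] by simp
  next
    case (3 i)
    show ?thesis
    proof (cases i)
      case 0
      then show ?thesis using 3 by (auto simp: ladder_def)
    next
      case (Suc j)
      define p where "p = (if t j then 2*j + 1 else 2*j + 2)"
      have j: "y = 2*j + 4" "j < k" using 3 Suc less.prems by auto
      then have "(p, y) \<in> ladder t k" by (auto simp: ladder_def p_def)
      moreover have "(0, p) \<in> (ladder t k)\<^sup>*" using less.IH[of p] j by (auto simp: p_def)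
      ultimately show ?thesis by (rule rtrancl_into_rtrancl[rotated])
    qed
  qed
qed

text \<open>
  This excludes three-element antichains.  An odd \<open>y\<close> lies above all smaller vertices.  An even \<open>y\<close>
  covers a vertex \<open>p\<close> of the preceding rank.  If \<open>p\<close> is odd, everything up to \<open>p\<close> lies below \<open>y\<close>,
  and only two consecutive vertices, which are comparable, remain.  If \<open>p\<close> is even, either \<open>x'\<close>
  is the odd neighbour \<open>y - 1\<close>, which lies above \<open>x\<close>, or \<open>x' = p\<close>, or
  induction applies to \<open>p\<close> in place of \<open>y\<close>.
\<close>

lemma ladder_three_vertices:
  assumes "y \<le> 2*k + 3" "x < x'" "x' < y"
  shows "(x, y) \<in> (ladder t k)\<^sup>* \<or> (x', y) \<in> (ladder t k)\<^sup>* \<or> (x, x') \<in> (ladder t k)\<^sup>*"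
  using assms
proof (induction y rule: less_induct)
  case (less y)
  show ?case
  proof (cases y rule: ladder_vertex_cases)
    case 1
    then show ?thesis using less.prems by simp
  next
    case (2 i)
    then show ?thesis using less.prems ladder_below_odd[of y k x t] by simp
  next
    case (3 i)
    show ?thesis
    proof (cases i)
      case 0
      then have "x = 0" "x' = 1" using 3 less.prems by auto
      then show ?thesis by (auto simp: ladder_def)
    next
      case (Suc j)
      define p where "p = (if t j then 2*j + 1 else 2*j + 2)"
      have j: "y = 2*j + 4" "j < k" using 3 Suc less.prems by auto
      then have edge: "(p, y) \<in> ladder t k" by (auto simp: ladder_def p_def)
      have via: "(q, y) \<in> (ladder t k)\<^sup>*" if "(q, p) \<in> (ladder t k)\<^sup>*" for q
        using that edge by (rule rtrancl_into_rtrancl)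
      show ?thesis
      proof (cases "x' = 2*j + 3")
        case True
        then show ?thesis using ladder_below_odd[of x' k x t] j less.prems by simp
      next
        case False
        then have x': "x' \<le> 2*j + 2" using j less.prems by simp
        show ?thesis
        proof (cases "t j")
          case True
          then have "(x, p) \<in> (ladder t k)\<^sup>*"
            using ladder_below_odd[of p k x t] j x' less.prems by (simp add: p_def)
          then show ?thesis using via by blast
        next
          case False
          then have p: "p = 2*j + 2" by (simp add: p_def)
          show ?thesis
          proof (cases "x' = p")
            case True
            then show ?thesis using via by blast
          next
            case False
            then show ?thesis using less.IH[of p] via p j x' less.prems by auto
          qed
        qed
      qed
    qed
  qed
qed

text \<open>
  There is no cut element, since the two vertices of a common rank are incomparable.
\<close>

lemma ladder_slim: "slim {0..2*k + 3} (ladder_order t k)"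
proof -
  have order: "(x, y) \<in> ladder_order t k \<longleftrightarrow> (x, y) \<in> (ladder t k)\<^sup>*"
    if "x \<le> 2*k + 3" "y \<le> 2*k + 3" for x y
    using that by (simp add: ladder_order_def)
  have "\<not> antichain_of_three {0..2*k + 3} (ladder_order t k)"
  proof
    assume "antichain_of_three {0..2*k + 3} (ladder_order t k)"
    then obtain x y z where le: "x \<le> 2*k + 3" "y \<le> 2*k + 3" "z \<le> 2*k + 3"
      and inc: "incomparable ((ladder t k)\<^sup>*) x y" "incomparable ((ladder t k)\<^sup>*) x z"
        "incomparable ((ladder t k)\<^sup>*) y z"
      unfolding antichain_of_three_def incomparable_def by (auto simp: order)
    have "x \<noteq> y" "x \<noteq> z" "y \<noteq> z" using inc by (auto simp: incomparable_def)
    then consider "x < y" "y < z" | "x < z" "z < y" | "y < x" "x < z" | "y < z" "z < x"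
      | "z < x" "x < y" | "z < y" "y < x" by linarith
    then show False
      using inc le unfolding incomparable_def by cases (metis ladder_three_vertices)+
  qed
  moreover have "\<not> cut_element {0..2*k + 3} (ladder_order t k) c" for c
  proof
    assume cut: "cut_element {0..2*k + 3} (ladder_order t k) c"
    then have c: "c \<le> 2*k + 3" by (simp add: cut_element_def)
    have cmp: "(c, x) \<in> (ladder t k)\<^sup>* \<or> (x, c) \<in> (ladder t k)\<^sup>*" if "x \<le> 2*k + 3" for x
    proof -
      have "x \<in> {0..2*k + 3}" using that by simp
      then have "(c, x) \<in> ladder_order t k \<or> (x, c) \<in> ladder_order t k"
        using cut unfolding cut_element_def by blast
      then show ?thesis using order[of c x] order[of x c] c that by blast
    qed
    have bot: "\<exists>x\<le>2*k + 3. (c, x) \<notin> (ladder t k)\<^sup>*"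
      and top: "\<exists>x\<le>2*k + 3. (x, c) \<notin> (ladder t k)\<^sup>*"
      using cut order c unfolding cut_element_def by (meson atLeastAtMost_iff)+
    have top': "c \<noteq> 2*k + 3"
      using top ladder_below_odd[of c k _ t] by auto
    show False
    proof (cases c rule: ladder_vertex_cases)
      case 1
      then show False using bot ladder_bottom by blast
    next
      case (2 i)
      then show False using cmp[of "2*i + 2"] ladder_rank[of _ _ t k] c top' by fastforce
    next
      case (3 i)
      then show False using cmp[of "2*i + 1"] ladder_rank[of _ _ t k] c by fastforce
    qed
  qed
  ultimately show ?thesis unfolding slim_def by blast
qed

section \<open>Slim lattices of ideals are ladders\<close>

context finite_poset
begin

lemma slim_ideals_ladder:
  assumes slim: "slim ideals (ideal_order P r)" and size: "card P = k + 2"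
  shows "\<exists>t. poset_isomorphic {0..2*k + 3} (ladder_order t k) ideals (ideal_order P r)"
proof -
  \<comment> \<open>\<open>A i\<close> and \<open>B i\<close> are the images of the vertices \<open>2*i + 1\<close> and \<open>2*i + 2\<close>, both of size \<open>i + 1\<close>.
    At the bottom level the two singletons may be taken in either order; above it \<open>A i\<close> has to be
    the union of the two ideals one level down.\<close>
  define A where "A i = (if i = 0 then SOME X. X \<in> level 1 else \<Union>(level i))" for i
  define B where "B i = (SOME Y. Y \<in> level (Suc i) \<and> Y \<noteq> A i)" for i
  have pairs: "\<exists>X Y. X \<noteq> Y \<and> level m = {X, Y} \<and> X \<union> Y \<in> level (Suc m)"
    if "0 < m" "m < k + 2" for m
  proof -
    have "m < card P" using that size by simp
    with slim \<open>0 < m\<close> show ?thesis by (rule level_pair) blast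
  qed
  have A_level: "A i \<in> level (Suc i)" if i: "i \<le> Suc k" for i
  proof (cases i)
    case 0
    obtain X Y where "level 1 = {X, Y}" using pairs[of 1] by auto
    then have "\<exists>X. X \<in> level 1" by auto
    then have "(SOME X. X \<in> level 1) \<in> level 1" by (rule someI_ex)
    then show ?thesis using 0 by (simp add: A_def)
  next
    case (Suc j)
    obtain X Y where "level (Suc j) = {X, Y}" "X \<union> Y \<in> level (Suc (Suc j))"
      using pairs[of "Suc j"] i Suc by auto
    then show ?thesis using Suc by (simp add: A_def)
  qed
  have pair: "level (Suc i) = {A i, B i} \<and> A i \<noteq> B i" if i: "i \<le> k" for i
  proof -
    obtain X Y where XY: "X \<noteq> Y" "level (Suc i) = {X, Y}"
      using pairs[of "Suc i"] i by auto
    then have "\<exists>Y. Y \<in> level (Suc i) \<and> Y \<noteq> A i" by auto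
    then have "B i \<in> level (Suc i) \<and> B i \<noteq> A i" unfolding B_def by (rule someI_ex)
    then show ?thesis using XY A_level[of i] i by auto
  qed
  have A_Suc: "A (Suc i) = A i \<union> B i" if "i \<le> k" for i
    using pair[OF that] by (simp add: A_def[of "Suc i"])
  define t where "t i = (A i \<subseteq> B (Suc i))" for i
  have t: "B i \<subseteq> B (Suc i) \<longleftrightarrow> \<not> t i" if "i < k" for i
    using one_lower_neighbour[of "Suc i" "A i" "B i" "B (Suc i)"] pair[of i] pair[of "Suc i"]
      A_Suc[of i] that by (auto simp: t_def)
  define f where "f y = (if y = 0 then {} else if odd y then A (y div 2) else B (y div 2 - 1))" for y
  have f_simps: "f 0 = {}" "f (2*i + 1) = A i" "f (2*i + 2) = B i" for i
    by (auto simp: f_def)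
  have f_next: "f (2*i + 3) = A (Suc i)" "f (2*i + 4) = B (Suc i)" for i
    using f_simps(2,3)[of "Suc i"] by (simp_all add: eval_nat_numeral)
  have f_level: "f y \<in> level ((y + 1) div 2)" if "y \<le> 2*k + 3" for y
  proof (cases y rule: ladder_vertex_cases)
    case 1
    then show ?thesis using empty_ideal by (simp add: f_simps level_def)
  next
    case (2 i)
    have "f y = A i" unfolding 2 by (rule f_simps)
    then show ?thesis using A_level[of i] that 2 by simp
  next
    case (3 i)
    have "f y = B i" unfolding 3 by (rule f_simps)
    then show ?thesis using pair[of i] that 3 by simp
  qed
  then have f_ideal: "f y \<in> ideals" and f_card: "card (f y) = (y + 1) div 2" if "y \<le> 2*k + 3" for y
    using that by (auto simp: level_def)
  have inj: "inj_on f {0..2*k + 3}"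
  proof (rule inj_onI)
    fix x y assume xy: "x \<in> {0..2*k + 3}" "y \<in> {0..2*k + 3}" "f x = f y"
    then have rank: "(x + 1) div 2 = (y + 1) div 2" using f_card[of x] f_card[of y] by simp
    have ne: "f (2*i + 1) \<noteq> f (2*i + 2)" if "i \<le> k" for i
      using pair[OF that] unfolding f_simps by simp
    show "x = y"
      by (cases x rule: ladder_vertex_cases; cases y rule: ladder_vertex_cases)
         (use xy rank ne in \<open>auto dest: sym\<close>)
  qed
  have surj: "\<exists>y\<le>2*k + 3. X = f y" if X: "X \<in> ideals" for X
  proof -
    have "card X \<le> k + 2"
      using card_mono[OF finite_carrier ideal_subset[OF X]] size by simp
    then consider "card X = 0" | i where "card X = Suc i" "i \<le> k" | "card X = k + 2"
      by (metis add_2_eq_Suc' le_Suc_eq not0_implies_Suc Suc_le_mono)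
    then show ?thesis
    proof cases
      case 1
      then show ?thesis using finite_ideal[OF X] f_simps(1) by (intro exI[of _ 0]) simp
    next
      case (2 i)
      then have "X = A i \<or> X = B i" using X pair[of i] by (auto simp: level_def)
      then have "X = f (2*i + 1) \<or> X = f (2*i + 2)" unfolding f_simps .
      moreover have "2*i + 1 \<le> 2*k + 3" "2*i + 2 \<le> 2*k + 3" using 2 by auto
      ultimately show ?thesis by blast
    next
      case 3
      have full: "Z = P" if "Z \<in> ideals" "card Z = k + 2" for Z
        using card_subset_eq[OF finite_carrier ideal_subset[OF that(1)]] that(2) size by simp
      have "f (2*k + 3) = P" by (rule full) (simp_all add: f_ideal f_card)
      moreover have "X = P" using X 3 by (rule full)
      ultimately show ?thesis by blast
    qed
  qed
  have cover: "f x \<subseteq> f y \<longleftrightarrow> (x, y) \<in> ladder t k"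
    if le: "x \<le> 2*k + 3" "y \<le> 2*k + 3" and rank: "(y + 1) div 2 = Suc ((x + 1) div 2)" for x y
  proof (cases x rule: ladder_vertex_cases)
    case 1
    then have "y = 1 \<or> y = 2" using rank by auto
    then show ?thesis using 1 by (auto simp: ladder_def f_simps(1))
  next
    case (2 i)
    then have "y = 2*i + 3 \<or> y = 2*i + 4" using rank by auto
    then show ?thesis
    proof
      assume y: "y = 2*i + 3"
      have "f x = A i" "f y = A (Suc i)" unfolding 2 y by (rule f_simps f_next)+
      then show ?thesis using A_Suc[of i] le 2 y by (auto simp: ladder_def)
    next
      assume y: "y = 2*i + 4"
      have "f x = A i" "f y = B (Suc i)" unfolding 2 y by (rule f_simps f_next)+
      then show ?thesis using le 2 y by (auto simp: ladder_def t_def)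
    qed
  next
    case (3 i)
    then have "y = 2*i + 3 \<or> y = 2*i + 4" using rank by auto
    then show ?thesis
    proof
      assume y: "y = 2*i + 3"
      have "f x = B i" "f y = A (Suc i)" unfolding 3 y by (rule f_simps f_next)+
      then show ?thesis using A_Suc[of i] le 3 y by (auto simp: ladder_def)
    next
      assume y: "y = 2*i + 4"
      have "f x = B i" "f y = B (Suc i)" unfolding 3 y by (rule f_simps f_next)+
      moreover have "(x, y) \<in> ladder t k \<longleftrightarrow> \<not> t i"
        using le unfolding 3 y by (auto simp: ladder_def; presburger)
      ultimately show ?thesis using t[of i] le 3 y by simp
    qed
  qed
  have edge: "x \<le> 2*k + 3 \<and> y \<le> 2*k + 3 \<and> (y + 1) div 2 = Suc ((x + 1) div 2)"
    if "(x, y) \<in> ladder t k" for x y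
    using that by (auto simp: ladder_def)
  have path_imp: "f x \<subseteq> f y" if "(x, y) \<in> (ladder t k)\<^sup>*" for x y
    using that by (induction rule: rtrancl_induct) (use edge cover in blast)+
  \<comment> \<open>Descend from \<open>f y\<close> to \<open>f x\<close> through ideals of decreasing size; inclusions between consecutive
    sizes are cover relations of the ladder.\<close>
  have imp_path: "(x, y) \<in> (ladder t k)\<^sup>*" if "x \<le> 2*k + 3" "y \<le> 2*k + 3" "f x \<subseteq> f y" for x y
    using that
  proof (induction "(y + 1) div 2" arbitrary: y)
    case 0
    then have "y = 0" by simp
    moreover have "f x = {}" using 0 \<open>y = 0\<close> f_simps(1) by simp
    then have "x = 0" using inj 0 f_simps(1) by (auto dest: inj_onD)
    ultimately show ?case by simp
  next
    case (Suc m)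
    show ?case
    proof (cases "x = y")
      case False
      then have "f x \<noteq> f y" using inj Suc.prems by (auto dest: inj_onD)
      then have "f x \<subset> f y" using Suc.prems by blast
      then have "card (f x) < card (f y)"
        using finite_ideal[OF f_ideal] Suc.prems psubset_card_mono by blast
      then have "card (f x) \<le> m" "m \<le> card (f y)" using f_card Suc by auto
      then obtain C where C: "C \<in> level m" "f x \<subseteq> C" "C \<subseteq> f y"
        using ideal_between[OF f_ideal f_ideal] Suc.prems by metis
      then obtain z where z: "z \<le> 2*k + 3" "C = f z"
        using surj[of C] unfolding level_def by blast
      then have m: "m = (z + 1) div 2" using C f_card by (simp add: level_def)
      then have "(x, z) \<in> (ladder t k)\<^sup>*" using Suc.hyps(1)[of z] z C Suc.prems by simp
      moreover have "(z, y) \<in> ladder t k" using cover[of z y] z C Suc m by simp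
      ultimately show ?thesis by (rule rtrancl_into_rtrancl)
    qed simp
  qed
  have "bij_betw f {0..2*k + 3} ideals"
    unfolding bij_betw_def using inj surj f_ideal by fastforce
  moreover have "(x, y) \<in> ladder_order t k \<longleftrightarrow> (f x, f y) \<in> ideal_order P r"
    if "x \<in> {0..2*k + 3}" "y \<in> {0..2*k + 3}" for x y
    using that path_imp imp_path f_ideal by (auto simp: ladder_order_def ideal_order_iff)
  ultimately show ?thesis unfolding poset_isomorphic_def by blast
qed

end

theorem proposition4p9:
  fixes P :: "'a set" and r :: "'a rel"
  assumes "partial_order_on P r" and "finite P" and "card P \<ge> 2"
  shows "(two_two_one_one_one_free P r \<and> ordinal_sum_irreducible P r) \<longleftrightarrow>
         isomorphic_to_generalized_snake_poset (poset_ideals P r) (ideal_order P r)"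
proof -
  interpret finite_poset P r using assms by unfold_locales
  obtain k where k: "card P = k + 2" using assms(3) by (metis add.commute le_Suc_ex)
  have "(two_two_one_one_one_free P r \<and> ordinal_sum_irreducible P r) \<longleftrightarrow>
        slim ideals (ideal_order P r)"
    by (simp add: slim_def free_iff_no_ideal_antichain irreducible_iff_no_cut_ideal)
  also have "\<dots> \<longleftrightarrow> isomorphic_to_generalized_snake_poset ideals (ideal_order P r)"
    unfolding generalized_snake_iff_ladder
    using slim_ideals_ladder[OF _ k] slim_if_isomorphic[OF _ ladder_slim] poset_isomorphic_sym
    by blast
  finally show ?thesis .
qed

end
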